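(* Let $\omega\in\mathcal M$ be a concave modulus and let $X$ be a super-reflexive Banach space that has an equivalent norm with modulus of smoothness of power type $2$. Let $E\subset X$ and let $f$ be a real function on $E$. Then $f$ can be extended to a function $F\in C^{1,\omega}(X)$ if and only if the following condition holds: $(\mathrm{WG}_\omega)$: there exist a mapping $G\colon E\to X^*$ and $M>0$ such that $$\|G(y)-G(x)\|\le M\omega(\|y-x\|),$$ $$|f(y)-f(x)-\langle G(x),y-x\rangle|\le M\omega(\|y-x\|)\,\|y-x\|$$ for each $x,y\in E$. Moreover, if $(\mathrm{WG}_\omega)$ is satisfied with a mapping $G$, then $F$ can be found such that $DF(x)=G(x)$ for each $x\in E$.
   Context: All normed linear spaces are real; $\langle g,x\rangle=g(x)$ for $g\in X^*$, $x\in X$, and $DF$ denotes the Fréchet derivative of $F$. $\mathcal M$ is the set of all functions $\omega\colon[0,+\infty)\to[0,+\infty)$ that are non-decreasing and continuous at $0$ with $\omega(0)=0$. For an open subset $U$ of a normed linear space and $\omega\in\mathcal M$, $C^{1,\omega}(U)$ is the set of all Fréchet differentiable $f\colon U\to\mathbb R$ for which there is $C\ge0$ with $\|Df(x)-Df(y)\|\le C\omega(\|x-y\|)$ for all $x,y\in U$. The modulus of smoothness of a norm $\|\cdot\|$ on $X$ is $\rho(\tau)=\sup\{\frac{\|x+\tau y\|+\|x-\tau y\|}{2}-1 : x,y\in X,\ \|x\|=\|y\|=1\}$, $\tau\ge0$; it is of power type $p>1$ if there is $K>0$ with $\rho(\tau)\le K\tau^p$ for all $\tau\ge0$. A Banach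 space is super-reflexive if and only if it has an equivalent uniformly smooth norm. *)

theory Defs
  imports "HOL-Analysis.Analysis"
begin

text \<open>A function on the half-line is a total function on the reals; its values at negative
  arguments are never used.\<close>

definition moduli :: "(real \<Rightarrow> real) set" where
  "moduli = {\<omega>. (\<forall>t\<ge>0. \<omega> t \<ge> 0) \<and> mono_on {0..} \<omega> \<and>
     continuous (at 0 within {0..}) \<omega> \<and> \<omega> 0 = 0}"

text \<open>The dual space carries the operator norm of bounded linear functionals. For open \<open>U\<close>
  the derivative is unique on \<open>U\<close>, so \<open>D\<close> is determined there.\<close>

definition C1_mod :: "'a::real_normed_vector set \<Rightarrow> (real \<Rightarrow> real) \<Rightarrow> ('a \<Rightarrow> real) set" where
  "C1_mod U \<omega> = {F. \<exists>D :: 'a \<Rightarrow> 'a \<Rightarrow>\<^sub>L real.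
     (\<forall>x\<in>U. (F has_derivative blinfun_apply (D x)) (at x)) \<and>
     (\<exists>C\<ge>0. \<forall>x\<in>U. \<forall>y\<in>U. norm (D x - D y) \<le> C * \<omega> (norm (x - y)))}"

definition is_norm :: "('a::real_vector \<Rightarrow> real) \<Rightarrow> bool" where
  "is_norm \<nu> \<longleftrightarrow> (\<forall>x. \<nu> x \<ge> 0) \<and> (\<forall>x. \<nu> x = 0 \<longleftrightarrow> x = 0) \<and>
     (\<forall>c x. \<nu> (c *\<^sub>R x) = \<bar>c\<bar> * \<nu> x) \<and> (\<forall>x y. \<nu> (x + y) \<le> \<nu> x + \<nu> y)"

definition equivalent_norm :: "('a::real_normed_vector \<Rightarrow> real) \<Rightarrow> bool" where
  "equivalent_norm \<nu> \<longleftrightarrow> is_norm \<nu> \<and>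
     (\<exists>a>0. \<exists>b>0. \<forall>x. a * norm x \<le> \<nu> x \<and> \<nu> x \<le> b * norm x)"

text \<open>For a norm \<open>\<nu>\<close> and \<open>\<tau> \<ge> 0\<close> the numbers in the comprehension lie between \<open>0\<close> and \<open>\<tau>\<close>, so
  inserting \<open>0\<close> only matters on the zero space, where the unit sphere is empty and the
  real supremum would otherwise be unspecified.\<close>

definition modulus_of_smoothness :: "('a::real_vector \<Rightarrow> real) \<Rightarrow> real \<Rightarrow> real" where
  "modulus_of_smoothness \<nu> \<tau> =
     Sup (insert 0 {(\<nu> (x + \<tau> *\<^sub>R y) + \<nu> (x - \<tau> *\<^sub>R y)) / 2 - 1 | x y. \<nu> x = 1 \<and> \<nu> y = 1})"

definition smoothness_power_type :: "('a::real_vector \<Rightarrow> real) \<Rightarrow> real \<Rightarrow> bool" where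
  "smoothness_power_type \<nu> p \<longleftrightarrow>
     (\<exists>K>0. \<forall>\<tau>\<ge>0. modulus_of_smoothness \<nu> \<tau> \<le> K * \<tau> powr p)"

definition uniformly_smooth :: "('a::real_vector \<Rightarrow> real) \<Rightarrow> bool" where
  "uniformly_smooth \<nu> \<longleftrightarrow> ((\<lambda>\<tau>. modulus_of_smoothness \<nu> \<tau> / \<tau>) \<longlongrightarrow> 0) (at_right 0)"

text \<open>Super-reflexivity is taken in the form of the existence of an equivalent uniformly smooth
  norm; by a theorem of Enflo this is equivalent to the definition through finite
  representability.\<close>

definition super_reflexive :: "'a::banach itself \<Rightarrow> bool" where
  "super_reflexive _ \<longleftrightarrow> (\<exists>\<nu> :: 'a \<Rightarrow> real. equivalent_norm \<nu> \<and> uniformly_smooth \<nu>)"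

definition WG :: "(real \<Rightarrow> real) \<Rightarrow> 'a::real_normed_vector set \<Rightarrow> ('a \<Rightarrow> real) \<Rightarrow>
    ('a \<Rightarrow> 'a \<Rightarrow>\<^sub>L real) \<Rightarrow> bool" where
  "WG \<omega> E f G \<longleftrightarrow> (\<exists>M>0. \<forall>x\<in>E. \<forall>y\<in>E.
     norm (G y - G x) \<le> M * \<omega> (norm (y - x)) \<and>
     \<bar>f y - f x - blinfun_apply (G x) (y - x)\<bar> \<le> M * \<omega> (norm (y - x)) * norm (y - x))"

end

theory Submission
  imports Defs
begin

text \<open>
  That an extension gives the Whitney condition is the mean value inequality
  (\<open>WG_if_C1_mod\<close>). For the converse, write \<open>\<psi> v = p v * \<omega> (p v)\<close>, where \<open>p\<close> is an equivalent norm with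
  modulus of smoothness of power type 2. Each point \<open>y \<in> E\<close> contributes an upper and a lower barrier,
  \<open>f y + G y (x - y) + A * \<psi> (x - y)\<close> and \<open>f y + G y (x - y) - A * \<psi> (x - y)\<close>. By the Whitney
  condition, for large \<open>A\<close> every lower barrier lies below every upper one (\<open>jet_compatibility\<close>).
  A function between the two families agrees with \<open>f\<close> on \<open>E\<close> and has derivative \<open>G y\<close> at \<open>y \<in> E\<close>, because \<open>\<psi> v\<close> is \<open>o(\<parallel>v\<parallel>)\<close>.

  It remains to find such a function in \<open>C\<^sup>1\<^sup>,\<^sup>\<omega>\<close>. Call \<open>u\<close> semiconvex with error \<open>\<sigma>\<close> if it satisfies
  the convexity inequality up to \<open>l (1 - l) \<sigma> (x - y)\<close>. Three facts suffice.

  First, \<open>- \<psi>\<close> is semiconvex with error a multiple of \<open>\<parallel>v\<parallel> \<omega>(\<parallel>v\<parallel>)\<close>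
  (\<open>gauge_of_norm_semiconcave\<close>). This is the only place where the geometry of the space enters:
  power type 2 makes \<open>- p\<^sup>2\<close> semiconvex with error \<open>C p\<^sup>2\<close> (\<open>square_semiconcave\<close>), and concavity of
  \<open>\<omega>\<close> makes \<open>t \<omega>(t)\<close> a concave function of \<open>t\<^sup>2\<close> (\<open>gauge_quadratic_majorant\<close>). No derivative of
  the norm is used.

  Second, between lower barriers that are semiconvex and upper barriers that are semiconcave there
  is a function that is both, with the same \<open>\<sigma>\<close> (\<open>semiconvex_semiconcave_insertion\<close>, a form of
  Ilmanen's lemma). It is the largest semiconvex function \<open>F\<close> below the upper barriers: averages of
  translates of \<open>F\<close>, lowered by the error allowed to the barriers, compete in the definition of \<open>F\<close>.

  Third, a locally bounded function that is semiconvex and semiconcave with error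
  \<open>N \<parallel>v\<parallel> \<omega>(\<parallel>v\<parallel>)\<close> is in \<open>C\<^sup>1\<^sup>,\<^sup>\<omega>\<close> (\<open>C1_mod_if_semiconvex_semiconcave\<close>).
\<close>

section \<open>Concave moduli\<close>

locale concave_modulus =
  fixes \<omega> :: "real \<Rightarrow> real"
  assumes modulus: "\<omega> \<in> moduli" and concave: "concave_on {0..} \<omega>"
begin

lemma zero [simp]: "\<omega> 0 = 0"
  using modulus by (simp add: moduli_def)

lemma nonneg: "0 \<le> t \<Longrightarrow> 0 \<le> \<omega> t"
  using modulus by (simp add: moduli_def)

lemma mono: "0 \<le> s \<Longrightarrow> s \<le> t \<Longrightarrow> \<omega> s \<le> \<omega> t"
  using modulus by (auto simp: moduli_def mono_on_def)

lemma tendsto_zero: "(\<omega> \<longlongrightarrow> 0) (at 0 within {0..})"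
  using modulus by (auto simp: moduli_def continuous_within)

lemma scale:
  assumes "1 \<le> c" "0 \<le> t"
  shows "\<omega> (c * t) \<le> c * \<omega> t"
proof -
  have "\<omega> ((1 - 1/c) *\<^sub>R 0 + (1/c) *\<^sub>R (c * t)) \<ge> (1 - 1/c) * \<omega> 0 + (1/c) * \<omega> (c * t)"
    using concave assms by (intro concave_onD) auto
  then have "\<omega> t \<ge> \<omega> (c * t) / c"
    using assms by simp
  then show ?thesis
    using assms by (simp add: field_simps)
qed

lemma quotient_antimono:
  assumes "0 < s" "s \<le> t"
  shows "\<omega> t * s \<le> \<omega> s * t"
  using scale[of "t / s" s] assms by (simp add: field_simps)

lemma gauge_mono:
  assumes "0 \<le> s" "s \<le> t"
  shows "s * \<omega> s \<le> t * \<omega> t"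
  using assms mono[of s t] nonneg[of s] by (intro mult_mono) auto

lemma gauge_scale:
  assumes "1 \<le> c" "0 \<le> t"
  shows "(c * t) * \<omega> (c * t) \<le> c\<^sup>2 * (t * \<omega> t)"
proof -
  have "(c * t) * \<omega> (c * t) \<le> (c * t) * (c * \<omega> t)"
    using assms scale[of c t] by (intro mult_left_mono) auto
  then show ?thesis
    by (simp add: power2_eq_square algebra_simps)
qed

text \<open>The product \<open>t * \<omega> t\<close> takes the place of the primitive of \<open>\<omega>\<close>: it is comparable to it, and this
  estimate is its substitute for having derivative \<open>\<omega>\<close>.\<close>

lemma gauge_increment:
  assumes "0 \<le> s" "s \<le> t"
  shows "t * \<omega> t - s * \<omega> s \<le> 2 * (t - s) * \<omega> t"
proof (cases "s = 0")
  case True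
  then show ?thesis using assms nonneg[of t] by simp
next
  case False
  then have "\<omega> t * s \<le> \<omega> s * t"
    using assms by (intro quotient_antimono) auto
  moreover have "(t - s) * \<omega> s \<le> (t - s) * \<omega> t"
    using assms mono by (intro mult_left_mono) auto
  ultimately show ?thesis by (simp add: algebra_simps)
qed

text \<open>As a function of \<open>t\<^sup>2\<close>, the product \<open>t * \<omega> t\<close> is concave: \<open>\<omega>\<close> is a lower envelope of functions
  \<open>a * t + b\<close> with \<open>a, b \<ge> 0\<close>, and \<open>a * t\<^sup>2 + b * t\<close> is concave in \<open>t\<^sup>2\<close>. The number \<open>m\<close> is the slope of a
  supporting line, and the bound on it comes from that of the slope \<open>a\<close> by \<open>\<omega> t\<^sub>0 / t\<^sub>0\<close>.\<close>

lemma gauge_quadratic_majorant: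
  assumes "0 < t\<^sub>0"
  obtains m where "0 \<le> m" "m * t\<^sub>0 \<le> \<omega> t\<^sub>0"
    "\<And>t. 0 \<le> t \<Longrightarrow> t * \<omega> t \<le> t\<^sub>0 * \<omega> t\<^sub>0 + m * (t\<^sup>2 - t\<^sub>0\<^sup>2)"
proof -
  define a where "a = - Inf ((\<lambda>t. (- \<omega> t\<^sub>0 - (- \<omega> t)) / (t\<^sub>0 - t)) ` ({t\<^sub>0<..} \<inter> {0..}))"
  have conv: "convex_on {0..} (\<lambda>t. - \<omega> t)"
    using concave by (simp add: concave_on_def)
  have int: "t\<^sub>0 \<in> interior {0..}"
    using assms by simp
  \<comment> \<open>\<open>a\<close> is the right derivative of \<open>\<omega>\<close> at \<open>t\<^sub>0\<close>\<close>
  have tangent: "\<omega> t \<le> \<omega> t\<^sub>0 + a * (t - t\<^sub>0)" if "0 \<le> t" for t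
    using convex_le_Inf_differential[OF conv int, of t] that by (simp add: a_def)
  have a: "0 \<le> a" "a * t\<^sub>0 \<le> \<omega> t\<^sub>0"
    using tangent[of "t\<^sub>0 + 1"] mono[of t\<^sub>0 "t\<^sub>0 + 1"] tangent[of 0] assms
    by simp_all
  define b where "b = \<omega> t\<^sub>0 - a * t\<^sub>0"
  have b: "0 \<le> b" using a by (simp add: b_def)
  show thesis
  proof
    show "0 \<le> a + b / (2 * t\<^sub>0)"
      using a b assms by simp
    show "(a + b / (2 * t\<^sub>0)) * t\<^sub>0 \<le> \<omega> t\<^sub>0"
      using a b assms by (simp add: b_def field_simps)
    fix t :: real assume t: "0 \<le> t"
    have "t * \<omega> t \<le> t * (a * t + b)"
      using tangent[OF t] t by (intro mult_left_mono) (auto simp: b_def algebra_simps)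
    \<comment> \<open>the linear term becomes quadratic by \<open>2 t t\<^sub>0 \<le> t\<^sup>2 + t\<^sub>0\<^sup>2\<close>, with equality at \<open>t\<^sub>0\<close>\<close>
    also have "b * (2 * t * t\<^sub>0) \<le> b * (t\<^sup>2 + t\<^sub>0\<^sup>2)"
      using b sum_squares_bound[of t t\<^sub>0] by (intro mult_left_mono) auto
    then have "t * (a * t + b) \<le> a * t\<^sup>2 + b * (t\<^sup>2 + t\<^sub>0\<^sup>2) / (2 * t\<^sub>0)"
      using assms by (simp add: field_simps power2_eq_square)
    also have "\<dots> = t\<^sub>0 * \<omega> t\<^sub>0 + (a + b / (2 * t\<^sub>0)) * (t\<^sup>2 - t\<^sub>0\<^sup>2)"
      using assms by (simp add: b_def field_simps power2_eq_square)
    finally show "t * \<omega> t \<le> t\<^sub>0 * \<omega> t\<^sub>0 + (a + b / (2 * t\<^sub>0)) * (t\<^sup>2 - t\<^sub>0\<^sup>2)" .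
  qed
qed

lemma eq_zero_if_le_modulus:
  assumes "0 \<le> c" and bound: "\<And>s. 0 < s \<Longrightarrow> \<bar>a\<bar> \<le> k * \<omega> (s * c)"
  shows "a = (0::real)"
proof -
  have "((\<lambda>s. s * c) \<longlongrightarrow> 0 * c) (at_right 0)"
    by (intro tendsto_intros)
  then have lim: "((\<lambda>s. s * c) \<longlongrightarrow> 0) (at_right 0)" by simp
  have "((\<lambda>s. \<omega> (s * c)) \<longlongrightarrow> 0) (at_right 0)"
  proof (cases "c = 0")
    case False
    then have "filterlim (\<lambda>s. s * c) (at 0 within {0..}) (at_right 0)"
      using assms(1) lim by (auto simp: filterlim_at eventually_at_filter)
    then show ?thesis by (rule filterlim_compose[OF tendsto_zero])
  qed simp
  then have "((\<lambda>s. k * \<omega> (s * c)) \<longlongrightarrow> k * 0) (at_right 0)"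
    by (intro tendsto_intros)
  then have "\<bar>a\<bar> \<le> k * 0"
    by (rule tendsto_lowerbound) (auto simp: eventually_at_filter bound)
  then show ?thesis by simp
qed

end

section \<open>Semiconvex functions and insertion\<close>

text \<open>The inequality is imposed for all \<open>l\<close>, with the weight \<open>l * (1 - l)\<close>, and not only at midpoints:
  for \<open>\<sigma> v = \<parallel>v\<parallel> \<omega>(\<parallel>v\<parallel>)\<close> with \<open>\<omega>\<close> failing the Dini condition, bounds on second differences do not
  give differentiability. The error is an arbitrary function of the displacement, so that translates
  and averages of \<open>u\<close> keep it.\<close>

definition semiconvex :: "('a::real_vector \<Rightarrow> real) \<Rightarrow> ('a \<Rightarrow> real) \<Rightarrow> bool" where
  "semiconvex \<sigma> u \<longleftrightarrow> (\<forall>x y. \<forall>l\<in>{0..1}.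
     u (l *\<^sub>R x + (1 - l) *\<^sub>R y) \<le> l * u x + (1 - l) * u y + l * (1 - l) * \<sigma> (x - y))"

lemma semiconvexI:
  assumes "\<And>x y l. 0 \<le> l \<Longrightarrow> l \<le> 1 \<Longrightarrow>
    u (l *\<^sub>R x + (1 - l) *\<^sub>R y) \<le> l * u x + (1 - l) * u y + l * (1 - l) * \<sigma> (x - y)"
  shows "semiconvex \<sigma> u"
  using assms by (auto simp: semiconvex_def)

lemma semiconvexD:
  assumes "semiconvex \<sigma> u" "0 \<le> l" "l \<le> 1"
  shows "u (l *\<^sub>R x + (1 - l) *\<^sub>R y) \<le> l * u x + (1 - l) * u y + l * (1 - l) * \<sigma> (x - y)"
  using assms by (auto simp: semiconvex_def)

lemma semiconvex_Sup:
  fixes S :: "('a::real_vector \<Rightarrow> real) set"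
  assumes "S \<noteq> {}" and bdd: "\<And>x. bdd_above ((\<lambda>u. u x) ` S)"
    and semi: "\<And>u. u \<in> S \<Longrightarrow> semiconvex \<sigma> u"
  shows "semiconvex \<sigma> (\<lambda>x. SUP u\<in>S. u x)"
proof (rule semiconvexI, rule cSUP_least[OF assms(1)])
  fix x y :: 'a and l :: real and u assume l: "0 \<le> l" "l \<le> 1" and u: "u \<in> S"
  have le: "u z \<le> (SUP u\<in>S. u z)" for z
    using u bdd by (rule cSUP_upper)
  have "u (l *\<^sub>R x + (1 - l) *\<^sub>R y) \<le> l * u x + (1 - l) * u y + l * (1 - l) * \<sigma> (x - y)"
    using semi[OF u] l by (rule semiconvexD)
  also have "\<dots> \<le> l * (SUP u\<in>S. u x) + (1 - l) * (SUP u\<in>S. u y) + l * (1 - l) * \<sigma> (x - y)"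
    using l le by (intro add_mono mult_left_mono) auto
  finally show "u (l *\<^sub>R x + (1 - l) *\<^sub>R y) \<le> \<dots>" .
qed

lemma semiconvex_average_of_translates:
  fixes u :: "'a::real_vector \<Rightarrow> real"
  assumes "semiconvex \<sigma> u" "0 \<le> k" "k \<le> 1"
  shows "semiconvex \<sigma> (\<lambda>z. k * u (z + a) + (1 - k) * u (z + b) - c)"
proof (rule semiconvexI)
  fix x y :: 'a and l :: real assume l: "0 \<le> l" "l \<le> 1"
  have translate: "u (l *\<^sub>R x + (1 - l) *\<^sub>R y + d)
      \<le> l * u (x + d) + (1 - l) * u (y + d) + l * (1 - l) * \<sigma> (x - y)" for d
    using semiconvexD[OF assms(1) l, of "x + d" "y + d"] by (simp add: algebra_simps)
  have "k * u (l *\<^sub>R x + (1 - l) *\<^sub>R y + a) + (1 - k) * u (l *\<^sub>R x + (1 - l) *\<^sub>R y + b)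
      \<le> k * (l * u (x + a) + (1 - l) * u (y + a) + l * (1 - l) * \<sigma> (x - y))
        + (1 - k) * (l * u (x + b) + (1 - l) * u (y + b) + l * (1 - l) * \<sigma> (x - y))"
    using assms(2,3) translate by (intro add_mono mult_left_mono) auto
  then show "k * u (l *\<^sub>R x + (1 - l) *\<^sub>R y + a) + (1 - k) * u (l *\<^sub>R x + (1 - l) *\<^sub>R y + b) - c
      \<le> l * (k * u (x + a) + (1 - k) * u (x + b) - c)
        + (1 - l) * (k * u (y + a) + (1 - k) * u (y + b) - c) + l * (1 - l) * \<sigma> (x - y)"
    by (simp add: algebra_simps)
qed

text \<open>The supremum \<open>F\<close> of all semiconvex functions below \<open>U\<close> is semiconvex. That it is also semiconcave
  follows from its maximality: the function
  \<open>H z = l * F (z + (1 - l) v) + (1 - l) * F (z - l v) - l * (1 - l) * \<sigma> v\<close> is semiconvex with the same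
  \<open>\<sigma>\<close>, being an average of translates, and it lies below each \<open>w \<in> U\<close> because \<open>w\<close> is semiconcave and
  above \<open>F\<close>. Hence \<open>H \<le> F\<close>, which is the semiconcavity inequality of \<open>F\<close>.\<close>

lemma semiconvex_semiconcave_insertion:
  fixes L U :: "('a::real_vector \<Rightarrow> real) set"
  assumes "L \<noteq> {}" "U \<noteq> {}"
    and L: "\<And>u. u \<in> L \<Longrightarrow> semiconvex \<sigma> u"
    and U: "\<And>w. w \<in> U \<Longrightarrow> semiconvex \<sigma> (\<lambda>x. - w x)"
    and LU: "\<And>u w x. u \<in> L \<Longrightarrow> w \<in> U \<Longrightarrow> u x \<le> w x"
  obtains F where "semiconvex \<sigma> F" "semiconvex \<sigma> (\<lambda>x. - F x)"
    "\<And>u x. u \<in> L \<Longrightarrow> u x \<le> F x" "\<And>w x. w \<in> U \<Longrightarrow> F x \<le> w x"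
proof -
  define S where "S = {u. semiconvex \<sigma> u \<and> (\<forall>w\<in>U. \<forall>x. u x \<le> w x)}"
  define F where "F = (\<lambda>x. SUP u\<in>S. u x)"
  have "L \<subseteq> S" using L LU by (auto simp: S_def)
  then have "S \<noteq> {}" using assms(1) by auto
  have bdd: "bdd_above ((\<lambda>u. u x) ` S)" for x
    using assms(2) by (auto simp: S_def bdd_above_def)
  have le_F: "u x \<le> F x" if "u \<in> S" for u x
    unfolding F_def using that bdd by (rule cSUP_upper)
  have F_le: "F x \<le> w x" if "w \<in> U" for w x
    unfolding F_def using \<open>S \<noteq> {}\<close> that by (intro cSUP_least) (auto simp: S_def)
  have F: "semiconvex \<sigma> F"
    unfolding F_def using \<open>S \<noteq> {}\<close> bdd by (rule semiconvex_Sup) (auto simp: S_def)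
  have "semiconvex \<sigma> (\<lambda>x. - F x)"
  proof (rule semiconvexI)
    fix x y :: 'a and l :: real assume l: "0 \<le> l" "l \<le> 1"
    define a b c where "a = (1 - l) *\<^sub>R (x - y)" and "b = - l *\<^sub>R (x - y)"
      and "c = l * (1 - l) * \<sigma> (x - y)"
    define H where "H = (\<lambda>z. l * F (z + a) + (1 - l) * F (z + b) - c)"
    have "H z \<le> w z" if w: "w \<in> U" for z w
    proof -
      have ab: "l *\<^sub>R (z + a) + (1 - l) *\<^sub>R (z + b) = z" "z + a - (z + b) = x - y"
        by (simp_all add: a_def b_def algebra_simps)
      have "H z \<le> l * w (z + a) + (1 - l) * w (z + b) - c"
        unfolding H_def using l F_le[OF w] by (intro add_mono diff_mono mult_left_mono) auto
      also have "\<dots> \<le> w z"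
        using semiconvexD[OF U[OF w] l, of "z + a" "z + b"] unfolding ab c_def by simp
      finally show ?thesis .
    qed
    then have "H \<in> S"
      using semiconvex_average_of_translates[OF F l] by (simp add: S_def H_def)
    from le_F[OF this, of "l *\<^sub>R x + (1 - l) *\<^sub>R y"]
    have "H (l *\<^sub>R x + (1 - l) *\<^sub>R y) \<le> F (l *\<^sub>R x + (1 - l) *\<^sub>R y)" .
    moreover have "l *\<^sub>R x + (1 - l) *\<^sub>R y + a = x" "l *\<^sub>R x + (1 - l) *\<^sub>R y + b = y"
      by (simp_all add: a_def b_def algebra_simps)
    ultimately show "- F (l *\<^sub>R x + (1 - l) *\<^sub>R y)
        \<le> l * - F x + (1 - l) * - F y + l * (1 - l) * \<sigma> (x - y)"
      by (simp add: H_def c_def)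
  qed
  with F le_F F_le \<open>L \<subseteq> S\<close> show thesis
    by (intro that) auto
qed

section \<open>Differentiability of functions that are semiconvex and semiconcave\<close>

context concave_modulus
begin

text \<open>The two-sided inequality on the segment from \<open>x\<close> to \<open>x + t v\<close> makes the difference quotients at
  \<open>s \<le> t\<close> differ by at most \<open>N \<parallel>v\<parallel> \<omega>(t \<parallel>v\<parallel>)\<close>; the factor \<open>l = s / t\<close> in the error cancels the division by
  \<open>s\<close>. So the quotients converge at this rate.\<close>

lemma directional_derivative:
  fixes F :: "'a::real_normed_vector \<Rightarrow> real"
  assumes N: "0 \<le> N" and F: "semiconvex (\<lambda>v. N * (norm v * \<omega> (norm v))) F"
    "semiconvex (\<lambda>v. N * (norm v * \<omega> (norm v))) (\<lambda>x. - F x)"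
  obtains L where "\<And>t. 0 < t \<Longrightarrow>
    \<bar>F (x + t *\<^sub>R v) - F x - t * L\<bar> \<le> N * (norm (t *\<^sub>R v) * \<omega> (norm (t *\<^sub>R v)))"
proof -
  define q where "q t = (F (x + t *\<^sub>R v) - F x) / t" for t
  define e where "e t = N * norm v * \<omega> (t * norm v)" for t
  have diff: "\<bar>q s - q t\<bar> \<le> e t" if "0 < s" "s \<le> t" for s t
  proof -
    have l: "0 \<le> s / t" "s / t \<le> 1" using that by auto
    have "(s / t) *\<^sub>R (x + t *\<^sub>R v) + (1 - s / t) *\<^sub>R x = x + s *\<^sub>R v"
      using that by (simp add: algebra_simps)
    then have "\<bar>F (x + s *\<^sub>R v) - (s / t * F (x + t *\<^sub>R v) + (1 - s / t) * F x)\<bar>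
        \<le> s / t * (1 - s / t) * (N * (t * norm v * \<omega> (t * norm v)))"
      using semiconvexD[OF F(1) l, of "x + t *\<^sub>R v" x] semiconvexD[OF F(2) l, of "x + t *\<^sub>R v" x]
        that by (auto simp: abs_le_iff)
    also have "\<dots> \<le> s / t * 1 * (N * (t * norm v * \<omega> (t * norm v)))"
      using that N l nonneg by (intro mult_right_mono mult_left_mono) auto
    also have "\<dots> = s * e t"
      using that by (simp add: e_def)
    also have "F (x + s *\<^sub>R v) - (s / t * F (x + t *\<^sub>R v) + (1 - s / t) * F x) = s * (q s - q t)"
      using that by (simp add: q_def field_simps)
    finally show ?thesis using that by (simp add: abs_mult)
  qed
  have lim_e: "(\<lambda>n. e (inverse (real (Suc n)))) \<longlonglongrightarrow> 0"
  proof (cases "v = 0")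
    case False
    have "(\<lambda>n. inverse (real (Suc n)) * norm v) \<longlonglongrightarrow> 0 * norm v"
      using LIMSEQ_inverse_real_of_nat by (rule tendsto_mult_right)
    then have "filterlim (\<lambda>n. inverse (real (Suc n)) * norm v) (at 0 within {0..}) sequentially"
      using False by (auto simp: filterlim_at)
    then have "(\<lambda>n. \<omega> (inverse (real (Suc n)) * norm v)) \<longlonglongrightarrow> 0"
      by (rule filterlim_compose[OF tendsto_zero])
    then have "(\<lambda>n. N * norm v * \<omega> (inverse (real (Suc n)) * norm v)) \<longlonglongrightarrow> N * norm v * 0"
      by (rule tendsto_mult_left)
    then show ?thesis by (simp add: e_def)
  qed (simp add: e_def)
  have "Cauchy (\<lambda>n. q (inverse (real (Suc n))))"
  proof (rule CauchyI')
    fix \<epsilon> :: real assume "0 < \<epsilon>"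
    with lim_e have "\<forall>\<^sub>F n in sequentially. e (inverse (real (Suc n))) < \<epsilon>"
      by (rule order_tendstoD)
    then obtain n\<^sub>0 where n\<^sub>0: "\<And>n. n\<^sub>0 \<le> n \<Longrightarrow> e (inverse (real (Suc n))) < \<epsilon>"
      by (auto simp: eventually_sequentially)
    have "dist (q (inverse (real (Suc m)))) (q (inverse (real (Suc n)))) < \<epsilon>"
      if "n\<^sub>0 \<le> m" "m < n" for m n
      using diff[of "inverse (real (Suc n))" "inverse (real (Suc m))"] n\<^sub>0[of m] that
      by (simp add: dist_real_def abs_minus_commute)
    then show "\<exists>M. \<forall>m\<ge>M. \<forall>n>m. dist (q (inverse (real (Suc m)))) (q (inverse (real (Suc n)))) < \<epsilon>"
      by blast
  qed
  then obtain L where L: "(\<lambda>n. q (inverse (real (Suc n)))) \<longlonglongrightarrow> L"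
    by (meson Cauchy_convergent_iff convergentD)
  show thesis
  proof
    fix t :: real assume t: "0 < t"
    have "(\<lambda>n. \<bar>q (inverse (real (Suc n))) - q t\<bar>) \<longlonglongrightarrow> \<bar>L - q t\<bar>"
      by (intro tendsto_intros L)
    moreover have "\<forall>\<^sub>F n in sequentially. \<bar>q (inverse (real (Suc n))) - q t\<bar> \<le> e t"
      using order_tendstoD(2)[OF LIMSEQ_inverse_real_of_nat t]
      by eventually_elim (auto intro: diff)
    ultimately have "\<bar>L - q t\<bar> \<le> e t"
      by (rule tendsto_upperbound) simp
    then have "t * \<bar>q t - L\<bar> \<le> t * e t"
      using t by (simp add: abs_minus_commute)
    moreover have "F (x + t *\<^sub>R v) - F x - t * L = t * (q t - L)"
      using t unfolding q_def right_diff_distrib by simp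
    ultimately show "\<bar>F (x + t *\<^sub>R v) - F x - t * L\<bar> \<le> N * (norm (t *\<^sub>R v) * \<omega> (norm (t *\<^sub>R v)))"
      using t by (simp add: e_def abs_mult mult_ac)
  qed
qed

lemma has_derivative_if_gauge_bound:
  fixes F :: "'a::real_normed_vector \<Rightarrow> real"
  assumes "bounded_linear L"
    and bound: "\<And>v. \<bar>F (x + v) - F x - L v\<bar> \<le> N * (norm v * \<omega> (norm v))"
  shows "(F has_derivative L) (at x)"
  unfolding has_derivative_at
proof (intro conjI assms(1))
  have "((\<lambda>v::'a. norm v) \<longlongrightarrow> norm (0::'a)) (at 0)"
    by (intro tendsto_intros)
  then have "filterlim (\<lambda>v::'a. norm v) (at 0 within {0..}) (at 0)"
    by (auto simp: filterlim_at eventually_at_filter)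
  then have "((\<lambda>v::'a. \<omega> (norm v)) \<longlongrightarrow> 0) (at 0)"
    by (rule filterlim_compose[OF tendsto_zero])
  then have lim: "((\<lambda>v::'a. N * \<omega> (norm v)) \<longlongrightarrow> 0) (at 0)"
    by (rule tendsto_mult_right_zero)
  have "norm (norm (F (x + v) - F x - L v) / norm v) \<le> N * \<omega> (norm v)" if "v \<noteq> 0" for v
    using bound[of v] that by (simp add: field_simps)
  then have "\<forall>\<^sub>F v in at 0. norm (norm (F (x + v) - F x - L v) / norm v) \<le> N * \<omega> (norm v)"
    by (auto simp: eventually_at_filter)
  then show "(\<lambda>v. norm (F (x + v) - F x - L v) / norm v) \<midarrow>0\<rightarrow> 0"
    using lim by (rule Lim_null_comparison)
qed

text \<open>A first-order Taylor bound that is uniform in the base point controls the derivative: with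
  \<open>h = x - y\<close> and \<open>\<parallel>v\<parallel> = \<parallel>h\<parallel>\<close>, going from \<open>y\<close> to \<open>y + h + v\<close> directly or through \<open>x\<close> compares \<open>D x v\<close> with
  \<open>D y v\<close>. The constant is \<open>6 = 4 + 1 + 1\<close>, where \<open>4\<close> comes from \<open>\<parallel>h + v\<parallel> \<le> 2 \<parallel>h\<parallel>\<close>.\<close>

lemma derivative_modulus_if_gauge_bound:
  fixes F :: "'a::real_normed_vector \<Rightarrow> real" and D :: "'a \<Rightarrow> 'a \<Rightarrow>\<^sub>L real"
  assumes N: "0 \<le> N"
    and bound: "\<And>x v. \<bar>F (x + v) - F x - D x v\<bar> \<le> N * (norm v * \<omega> (norm v))"
  shows "norm (D x - D y) \<le> 6 * N * \<omega> (norm (x - y))"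
proof (cases "x = y")
  case False
  define h where "h = x - y"
  define r where "r = norm h"
  have r: "0 < r" using False by (simp add: r_def h_def)
  have on_sphere: "\<bar>(D x - D y) v\<bar> \<le> 6 * N * (r * \<omega> r)" if v: "norm v = r" for v
  proof -
    have "norm (h + v) \<le> 2 * r"
      using norm_triangle_ineq[of h v] v by (simp add: r_def)
    then have "norm (h + v) * \<omega> (norm (h + v)) \<le> (2 * r) * \<omega> (2 * r)"
      by (intro gauge_mono) auto
    also have "\<dots> \<le> 4 * (r * \<omega> r)"
      using gauge_scale[of 2 r] r by simp
    finally have "N * (norm (h + v) * \<omega> (norm (h + v))) \<le> N * (4 * (r * \<omega> r))"
      using N by (rule mult_left_mono)
    then have "\<bar>F (y + (h + v)) - F y - D y (h + v)\<bar> \<le> 4 * (N * (r * \<omega> r))"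
      using bound[of y "h + v"] by simp
    moreover have "\<bar>F (x + v) - F x - D x v\<bar> \<le> N * (r * \<omega> r)"
      using bound[of x v] v by simp
    moreover have "\<bar>F (y + h) - F y - D y h\<bar> \<le> N * (r * \<omega> r)"
      using bound[of y h] by (simp add: r_def)
    moreover have "y + (h + v) = x + v" "y + h = x"
      by (simp_all add: h_def)
    ultimately show ?thesis
      by (simp add: blinfun.diff_left blinfun.add_right)
  qed
  have "norm (D x - D y) \<le> 6 * N * \<omega> r"
  proof (rule norm_blinfun_bound)
    show "0 \<le> 6 * N * \<omega> r" using N r nonneg by simp
    fix v :: 'a
    show "norm ((D x - D y) v) \<le> 6 * N * \<omega> r * norm v"
    proof (cases "v = 0")
      case False
      have "\<bar>(D x - D y) ((r / norm v) *\<^sub>R v)\<bar> \<le> 6 * N * (r * \<omega> r)"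
        using r False by (intro on_sphere) simp
      then show ?thesis
        using r False by (simp add: blinfun.scaleR_right abs_mult field_simps)
    qed simp
  qed
  then show ?thesis by (simp add: r_def h_def)
qed simp

text \<open>The one-sided directional derivatives are additive by the midpoint case of the two inequalities,
  hence linear, and bounded because \<open>F\<close> is bounded on each unit sphere. The boundedness assumption
  rules out discontinuous linear functionals.\<close>

lemma C1_mod_if_semiconvex_semiconcave:
  fixes F :: "'a::real_normed_vector \<Rightarrow> real"
  assumes N: "0 \<le> N" and F: "semiconvex (\<lambda>v. N * (norm v * \<omega> (norm v))) F"
    "semiconvex (\<lambda>v. N * (norm v * \<omega> (norm v))) (\<lambda>x. - F x)"
    and bdd: "\<And>x. \<exists>c. \<forall>v. norm v = 1 \<longrightarrow> \<bar>F (x + v)\<bar> \<le> c"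
  shows "F \<in> C1_mod UNIV \<omega>"
proof -
  define g where "g r = r * \<omega> r" for r :: real
  have "\<forall>x v. \<exists>L. \<forall>t>0. \<bar>F (x + t *\<^sub>R v) - F x - t * L\<bar> \<le> N * g (norm (t *\<^sub>R v))"
    unfolding g_def using directional_derivative[OF N F] by metis
  then obtain d where d: "\<And>x v t. 0 < t \<Longrightarrow>
      \<bar>F (x + t *\<^sub>R v) - F x - t * d x v\<bar> \<le> N * g (norm (t *\<^sub>R v))"
    by metis
  have g_le: "g a \<le> b * \<omega> c" if "0 \<le> a" "a \<le> b" "a \<le> c" for a b c
    using that mono[of a c] nonneg[of a] by (auto simp: g_def intro!: mult_mono)
  have add: "d x (u + v) = d x u + d x v" for x u v
  proof -
    define R where "R = norm u + norm v"
    have R: "0 \<le> R" by (simp add: R_def)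
    have "\<bar>d x (u + v) - d x u - d x v\<bar> \<le> (4 * N * R) * \<omega> (s * (2 * R))" if s: "0 < s" for s
    proof -
      define \<epsilon> where "\<epsilon> = N * ((2 * s * R) * \<omega> (s * (2 * R)))"
      have small: "N * g (norm w) \<le> \<epsilon>" if "norm w \<le> 2 * s * R" for w :: 'a
        unfolding \<epsilon>_def using that by (intro mult_left_mono N g_le) (auto simp: mult_ac)
      have norms: "norm (s *\<^sub>R (u + v)) \<le> s * R" "norm ((2 * s) *\<^sub>R u) \<le> 2 * s * R"
        "norm ((2 * s) *\<^sub>R v) \<le> 2 * s * R"
        "norm ((2 * s) *\<^sub>R u - (2 * s) *\<^sub>R v) \<le> 2 * s * R"
        using s norm_triangle_ineq[of u v] norm_triangle_ineq4[of u v]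
        by (simp_all add: R_def flip: scaleR_diff_right)
      have "N * g (norm (s *\<^sub>R (u + v))) \<le> \<epsilon> / 2"
      proof -
        have "N * g (norm (s *\<^sub>R (u + v))) \<le> N * ((s * R) * \<omega> (s * (2 * R)))"
          using s norms(1) R by (intro mult_left_mono N g_le) (auto simp: mult_ac)
        then show ?thesis by (simp add: \<epsilon>_def)
      qed
      then have 1: "\<bar>F (x + s *\<^sub>R (u + v)) - F x - s * d x (u + v)\<bar> \<le> \<epsilon> / 2"
        using d[OF s, of x "u + v"] by linarith
      have 2: "\<bar>F (x + (2 * s) *\<^sub>R w) - F x - 2 * s * d x w\<bar> \<le> \<epsilon>"
        if "norm ((2 * s) *\<^sub>R w) \<le> 2 * s * R" for w
        using d[of "2 * s" x w] small[OF that] s by simp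
      \<comment> \<open>\<open>x + s (u + v)\<close> is the midpoint of \<open>x + 2 s u\<close> and \<open>x + 2 s v\<close>\<close>
      have mid: "(1/2) *\<^sub>R (x + (2 * s) *\<^sub>R u) + (1 - 1/2) *\<^sub>R (x + (2 * s) *\<^sub>R v)
          = x + s *\<^sub>R (u + v)"
        by (simp add: algebra_simps flip: scaleR_add_left)
      have 3: "\<bar>F (x + s *\<^sub>R (u + v)) - (F (x + (2 * s) *\<^sub>R u) + F (x + (2 * s) *\<^sub>R v)) / 2\<bar>
          \<le> \<epsilon> / 4"
        using semiconvexD[OF F(1), of "1/2" "x + (2 * s) *\<^sub>R u" "x + (2 * s) *\<^sub>R v"]
          semiconvexD[OF F(2), of "1/2" "x + (2 * s) *\<^sub>R u" "x + (2 * s) *\<^sub>R v"]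
          small[OF norms(4)]
        unfolding mid g_def abs_le_iff by (simp add: add_divide_distrib)
      have "\<bar>s * (d x (u + v) - d x u - d x v)\<bar> \<le> 2 * \<epsilon>"
        using 1 2[OF norms(2)] 2[OF norms(3)] 3
        unfolding abs_le_iff right_diff_distrib add_divide_distrib by linarith
      also have "2 * \<epsilon> = s * ((4 * N * R) * \<omega> (s * (2 * R)))"
        by (simp add: \<epsilon>_def)
      finally show ?thesis using s by (simp add: abs_mult)
    qed
    from eq_zero_if_le_modulus[OF _ this] show ?thesis
      by (simp add: R_def)
  qed
  have pos: "d x (c *\<^sub>R v) = c * d x v" if c: "0 < c" for x c v
  proof -
    have "\<bar>d x (c *\<^sub>R v) - c * d x v\<bar> \<le> 2 * N * norm (c *\<^sub>R v) * \<omega> (s * norm (c *\<^sub>R v))"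
      if s: "0 < s" for s
    proof -
      have "\<bar>s * (d x (c *\<^sub>R v) - c * d x v)\<bar> \<le> 2 * (N * g (norm (s *\<^sub>R c *\<^sub>R v)))"
        using d[OF s, of x "c *\<^sub>R v"] d[of "s * c" x v] s c
        by (auto simp: abs_le_iff algebra_simps)
      also have "\<dots> = s * (2 * N * norm (c *\<^sub>R v) * \<omega> (s * norm (c *\<^sub>R v)))"
        using s c by (simp add: g_def abs_mult mult_ac)
      finally show ?thesis using s by (simp add: abs_mult)
    qed
    from eq_zero_if_le_modulus[OF _ this] show ?thesis by simp
  qed
  have zero': "d x 0 = 0" for x
    using add[of x 0 0] by simp
  have minus: "d x (- v) = - d x v" for x v
    using add[of x v "- v"] zero'[of x] by simp
  have scale': "d x (c *\<^sub>R v) = c * d x v" for x c v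
    using pos[of c x v] pos[of "- c" x v] minus[of x "c *\<^sub>R v"] zero'[of x]
    by (cases c "0::real" rule: linorder_cases) auto
  have "bounded_linear (d x)" for x
  proof -
    obtain c where c: "\<And>v. norm v = 1 \<Longrightarrow> \<bar>F (x + v)\<bar> \<le> c"
      using bdd by blast
    have unit: "\<bar>d x v\<bar> \<le> c + \<bar>F x\<bar> + N * g 1" if "norm v = 1" for v
      using d[of 1 x v] c[OF that] that by (auto simp: abs_le_iff)
    show ?thesis
    proof (rule bounded_linear_intro[where K = "c + \<bar>F x\<bar> + N * g 1"])
      fix v :: 'a
      show "norm (d x v) \<le> norm v * (c + \<bar>F x\<bar> + N * g 1)"
      proof (cases "v = 0")
        case False
        then have "v = norm v *\<^sub>R (v /\<^sub>R norm v)" by simp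
        then have "d x v = norm v * d x (v /\<^sub>R norm v)" by (metis scale')
        then show ?thesis
          using unit[of "v /\<^sub>R norm v"] False by (simp add: abs_mult)
      qed (simp add: zero')
    qed (auto simp: add scale')
  qed
  then have D: "blinfun_apply (Blinfun (d x)) = d x" for x
    by (simp add: bounded_linear_Blinfun_apply)
  have bound: "\<bar>F (x + v) - F x - Blinfun (d x) v\<bar> \<le> N * (norm v * \<omega> (norm v))" for x v
    using d[of 1 x v] by (simp add: D g_def)
  show ?thesis
    unfolding C1_mod_def
  proof (intro CollectI exI[of _ "\<lambda>x. Blinfun (d x)"] conjI ballI exI[of _ "6 * N"])
    show "(F has_derivative blinfun_apply (Blinfun (d x))) (at x)" for x
      using blinfun.bounded_linear_right bound by (rule has_derivative_if_gauge_bound)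
    show "norm (Blinfun (d x) - Blinfun (d y)) \<le> 6 * N * \<omega> (norm (x - y))" for x y
      using N bound by (rule derivative_modulus_if_gauge_bound)
  qed (use N in simp)
qed

end

section \<open>Norms of power type 2\<close>

lemma is_normD:
  assumes "is_norm \<nu>"
  shows "0 \<le> \<nu> x" "\<nu> x = 0 \<longleftrightarrow> x = 0" "\<nu> (c *\<^sub>R x) = \<bar>c\<bar> * \<nu> x" "\<nu> (x + y) \<le> \<nu> x + \<nu> y"
    "\<nu> (x - y) \<le> \<nu> x + \<nu> y" "\<nu> (- x) = \<nu> x" "\<nu> 0 = 0"
proof -
  have props: "\<And>x. 0 \<le> \<nu> x" "\<And>x. \<nu> x = 0 \<longleftrightarrow> x = 0" "\<And>c x. \<nu> (c *\<^sub>R x) = \<bar>c\<bar> * \<nu> x"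
    "\<And>x y. \<nu> (x + y) \<le> \<nu> x + \<nu> y"
    using assms by (auto simp: is_norm_def)
  have minus: "\<nu> (- x) = \<nu> x" for x
    using props(3)[of "-1" x] by simp
  show "0 \<le> \<nu> x" "\<nu> x = 0 \<longleftrightarrow> x = 0" "\<nu> (c *\<^sub>R x) = \<bar>c\<bar> * \<nu> x" "\<nu> (x + y) \<le> \<nu> x + \<nu> y"
    "\<nu> (x - y) \<le> \<nu> x + \<nu> y" "\<nu> (- x) = \<nu> x" "\<nu> 0 = 0"
    using props props(4)[of x "- y"] minus by auto
qed

lemma modulus_of_smoothness_upper:
  assumes \<nu>: "is_norm \<nu>" and "0 \<le> \<tau>" "\<nu> x = 1" "\<nu> y = 1"
  shows "(\<nu> (x + \<tau> *\<^sub>R y) + \<nu> (x - \<tau> *\<^sub>R y)) / 2 - 1 \<le> modulus_of_smoothness \<nu> \<tau>"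
  unfolding modulus_of_smoothness_def
proof (rule cSup_upper)
  have "(\<nu> (x + \<tau> *\<^sub>R y) + \<nu> (x - \<tau> *\<^sub>R y)) / 2 - 1 \<le> \<tau>" if "\<nu> x = 1" "\<nu> y = 1" for x y
    using is_normD(4,5)[OF \<nu>, of x "\<tau> *\<^sub>R y"] is_normD(3)[OF \<nu>, of \<tau> y] that assms(2) by (simp add: field_simps)
  then show "bdd_above (insert 0 {(\<nu> (x + \<tau> *\<^sub>R y) + \<nu> (x - \<tau> *\<^sub>R y)) / 2 - 1 | x y.
      \<nu> x = 1 \<and> \<nu> y = 1})"
    using assms(2) by (intro bdd_aboveI[of _ \<tau>]) auto
qed (use assms in auto)

text \<open>With \<open>a = \<nu> (x + h)\<close> and \<open>b = \<nu> (x - h)\<close>, power type 2 bounds \<open>a + b\<close> and the triangle inequality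
  bounds \<open>a - b\<close>, and \<open>a\<^sup>2 + b\<^sup>2 = ((a + b)\<^sup>2 + (a - b)\<^sup>2) / 2\<close>. The bound on \<open>a + b\<close> degenerates for small \<open>x\<close>;
  when \<open>\<nu> x \<le> \<nu> h\<close>, both terms are at most \<open>(2 * \<nu> h)\<^sup>2\<close>.\<close>

lemma square_second_difference:
  fixes \<nu> :: "'a::real_vector \<Rightarrow> real"
  assumes \<nu>: "is_norm \<nu>" and "smoothness_power_type \<nu> 2"
  obtains C where "0 \<le> C"
    "\<And>x h. (\<nu> (x + h))\<^sup>2 + (\<nu> (x - h))\<^sup>2 \<le> 2 * (\<nu> x)\<^sup>2 + 2 * C * (\<nu> h)\<^sup>2"
proof -
  note [simp] = is_normD(1)[OF \<nu>] is_normD(2)[OF \<nu>] is_normD(3)[OF \<nu>]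
  obtain K where K: "0 < K" and type: "\<And>\<tau>. 0 \<le> \<tau> \<Longrightarrow> modulus_of_smoothness \<nu> \<tau> \<le> K * \<tau>\<^sup>2"
    using assms(2) by (auto simp: smoothness_power_type_def)
  show thesis
  proof
    show "0 \<le> 2 * K\<^sup>2 + 4 * K + 4" using K by simp
    fix x h :: 'a
    define r s a b where "r = \<nu> x" and "s = \<nu> h" and "a = \<nu> (x + h)" and "b = \<nu> (x - h)"
    have nonneg: "0 \<le> r" "0 \<le> s" "0 \<le> a" "0 \<le> b"
      by (simp_all add: r_def s_def a_def b_def)
    have upper: "a \<le> r + s" "b \<le> r + s"
      using is_normD(4,5)[OF \<nu>, of x h] by (simp_all add: r_def s_def a_def b_def)
    have "a\<^sup>2 + b\<^sup>2 \<le> 2 * r\<^sup>2 + 2 * (2 * K\<^sup>2 + 4 * K + 4) * s\<^sup>2"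
    proof (cases "r \<le> s")
      case True
      then have "a\<^sup>2 \<le> (2 * s)\<^sup>2" "b\<^sup>2 \<le> (2 * s)\<^sup>2"
        using upper nonneg by (intro power_mono; simp)+
      then have "a\<^sup>2 + b\<^sup>2 \<le> 8 * s\<^sup>2"
        by (simp add: power_mult_distrib)
      also have "\<dots> \<le> (2 * (2 * K\<^sup>2 + 4 * K + 4)) * s\<^sup>2"
        using K by (intro mult_right_mono) auto
      also have "\<dots> \<le> 2 * r\<^sup>2 + 2 * (2 * K\<^sup>2 + 4 * K + 4) * s\<^sup>2"
        by simp
      finally show ?thesis .
    next
      case False
      have "a + b \<le> 2 * r + 2 * K * s\<^sup>2 / r"
      proof (cases "s = 0")
        case True
        then have "h = 0" by (simp add: s_def)
        then show ?thesis using True by (simp add: a_def b_def r_def)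
      next
        case s: False
        define \<tau> where "\<tau> = s / r"
        have r: "0 < r" using False nonneg by simp
        have "(\<nu> (x /\<^sub>R r + \<tau> *\<^sub>R (h /\<^sub>R s)) + \<nu> (x /\<^sub>R r - \<tau> *\<^sub>R (h /\<^sub>R s))) / 2 - 1
            \<le> modulus_of_smoothness \<nu> \<tau>"
          using \<nu> r s nonneg
          by (intro modulus_of_smoothness_upper)
            (auto simp: \<tau>_def r_def[symmetric] s_def[symmetric])
        also have "\<dots> \<le> K * \<tau>\<^sup>2"
          using r nonneg by (intro type) (simp add: \<tau>_def)
        also have "x /\<^sub>R r + \<tau> *\<^sub>R (h /\<^sub>R s) = inverse r *\<^sub>R (x + h)"
          using s r by (simp add: \<tau>_def algebra_simps field_simps)
        also have "\<nu> \<dots> = a / r"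
          using r by (simp add: a_def divide_inverse mult.commute)
        also have "x /\<^sub>R r - \<tau> *\<^sub>R (h /\<^sub>R s) = inverse r *\<^sub>R (x - h)"
          using s r by (simp add: \<tau>_def algebra_simps field_simps)
        also have "\<nu> \<dots> = b / r"
          using r by (simp add: b_def divide_inverse mult.commute)
        finally have "2 * r * ((a / r + b / r) / 2 - 1) \<le> 2 * r * (K * \<tau>\<^sup>2)"
          using r by (intro mult_left_mono) auto
        moreover have "2 * r * ((a / r + b / r) / 2 - 1) = a + b - 2 * r"
          using r by (simp add: field_simps)
        moreover have "2 * r * (K * \<tau>\<^sup>2) = 2 * K * s\<^sup>2 / r"
          using r by (simp add: \<tau>_def field_simps power2_eq_square)
        ultimately show ?thesis by simp
      qed
      moreover have "2 * K * s\<^sup>2 / r \<le> 2 * K * s"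
        using False nonneg K mult_right_mono[of s r s] by (simp add: field_simps power2_eq_square)
      ultimately have sum: "a + b - 2 * r \<le> 2 * K * s\<^sup>2 / r" "2 * K * s\<^sup>2 / r \<le> 2 * K * s" by simp_all
      define \<delta> where "\<delta> = 2 * K * s\<^sup>2 / r"
      have \<delta>: "0 \<le> \<delta>" "\<delta> \<le> 2 * K * s" "r * \<delta> = 2 * K * s\<^sup>2"
        using sum False nonneg K by (auto simp: \<delta>_def)
      have "(a + b)\<^sup>2 \<le> (2 * r + \<delta>)\<^sup>2"
        using sum nonneg by (intro power_mono) (auto simp: \<delta>_def)
      moreover have "\<delta>\<^sup>2 \<le> (2 * K * s)\<^sup>2"
        using \<delta> by (intro power_mono) auto
      moreover have "(a - b)\<^sup>2 \<le> (2 * s)\<^sup>2"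
      proof -
        have "a \<le> b + 2 * s" "b \<le> a + 2 * s"
          using is_normD(4)[OF \<nu>, of "x - h" "2 *\<^sub>R h"] is_normD(5)[OF \<nu>, of "x + h" "2 *\<^sub>R h"]
            is_normD(3)[OF \<nu>, of 2 h]
          by (simp_all add: a_def b_def s_def scaleR_2 algebra_simps)
        then have "\<bar>a - b\<bar> \<le> \<bar>2 * s\<bar>" using nonneg by simp
        then show ?thesis by (simp only: abs_le_square_iff)
      qed
      moreover have "a\<^sup>2 + b\<^sup>2 = ((a + b)\<^sup>2 + (a - b)\<^sup>2) / 2"
        by (simp add: power2_eq_square algebra_simps)
      moreover have "(2 * r + \<delta>)\<^sup>2 = 4 * r\<^sup>2 + 8 * (K * s\<^sup>2) + \<delta>\<^sup>2"
        using \<delta>(3) by (simp add: power2_sum power_mult_distrib mult_ac)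
      ultimately have "a\<^sup>2 + b\<^sup>2 \<le> 2 * r\<^sup>2 + (4 * (K * s\<^sup>2) + 2 * (K\<^sup>2 * s\<^sup>2) + 2 * s\<^sup>2)"
        by (simp add: power_mult_distrib)
      also have "4 * (K * s\<^sup>2) + 2 * (K\<^sup>2 * s\<^sup>2) + 2 * s\<^sup>2 = (4 * K + 2 * K\<^sup>2 + 2) * s\<^sup>2"
        by (simp add: algebra_simps)
      also have "\<dots> \<le> (2 * (2 * K\<^sup>2 + 4 * K + 4)) * s\<^sup>2"
        using K by (intro mult_right_mono) auto
      finally show ?thesis by simp
    qed
    then show "(\<nu> (x + h))\<^sup>2 + (\<nu> (x - h))\<^sup>2
        \<le> 2 * (\<nu> x)\<^sup>2 + 2 * (2 * K\<^sup>2 + 4 * K + 4) * (\<nu> h)\<^sup>2"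
      by (simp add: r_def s_def a_def b_def)
  qed
qed

text \<open>Rescaling makes the lower equivalence constant 1, so that \<open>p v * \<omega> (p v)\<close> dominates
  \<open>\<parallel>v\<parallel> \<omega>(\<parallel>v\<parallel>)\<close> without a constant.\<close>

lemma normalized_smooth_norm:
  assumes "\<exists>\<nu> :: 'a::real_normed_vector \<Rightarrow> real. equivalent_norm \<nu> \<and> smoothness_power_type \<nu> 2"
  obtains p :: "'a::real_normed_vector \<Rightarrow> real" and B C where "is_norm p" "1 \<le> B"
    "\<And>x. norm x \<le> p x" "\<And>x. p x \<le> B * norm x" "0 \<le> C"
    "\<And>x h. (p (x + h))\<^sup>2 + (p (x - h))\<^sup>2 \<le> 2 * (p x)\<^sup>2 + 2 * C * (p h)\<^sup>2"
proof -
  obtain \<nu> :: "'a \<Rightarrow> real" and a b where \<nu>: "is_norm \<nu>" "smoothness_power_type \<nu> 2" and ab: "0 < a"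
    "\<And>x. a * norm x \<le> \<nu> x" "\<And>x. \<nu> x \<le> b * norm x"
    using assms by (auto simp: equivalent_norm_def)
  obtain C where C: "0 \<le> C"
    "\<And>x h. (\<nu> (x + h))\<^sup>2 + (\<nu> (x - h))\<^sup>2 \<le> 2 * (\<nu> x)\<^sup>2 + 2 * C * (\<nu> h)\<^sup>2"
    using square_second_difference[OF \<nu>] by blast
  show thesis
  proof
    show "is_norm (\<lambda>x. \<nu> x / a)"
      using is_normD[OF \<nu>(1)] ab(1)
      by (auto simp: is_norm_def simp flip: add_divide_distrib intro!: divide_right_mono)
    show "norm x \<le> \<nu> x / a" for x
      using ab by (simp add: field_simps)
    show "\<nu> x / a \<le> max 1 (b / a) * norm x" for x
    proof -
      have "\<nu> x / a \<le> b / a * norm x"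
        using ab by (simp add: field_simps)
      also have "\<dots> \<le> max 1 (b / a) * norm x"
        by (intro mult_right_mono) auto
      finally show ?thesis .
    qed
    show "(\<nu> (x + h) / a)\<^sup>2 + (\<nu> (x - h) / a)\<^sup>2 \<le> 2 * (\<nu> x / a)\<^sup>2 + 2 * C * (\<nu> h / a)\<^sup>2" for x h
      using divide_right_mono[OF C(2)[of x h], of "a\<^sup>2"]
      by (simp add: power_divide add_divide_distrib)
  qed (use C in auto)
qed

text \<open>At a positive maximum \<open>t\<^sub>0 \<le> 1 / 2\<close> the value would be at most half of the value at \<open>2 * t\<^sub>0\<close>, since
  \<open>t\<^sub>0\<close> is the midpoint of \<open>0\<close> and \<open>2 * t\<^sub>0\<close>; for \<open>t\<^sub>0 > 1 / 2\<close> the endpoint \<open>1\<close> is used.\<close>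

lemma midpoint_convex_nonpos:
  fixes d :: "real \<Rightarrow> real"
  assumes cont: "continuous_on {0..1} d" and ends: "d 0 = 0" "d 1 = 0"
    and mid: "\<And>s t. s \<in> {0..1} \<Longrightarrow> t \<in> {0..1} \<Longrightarrow> d ((s + t) / 2) \<le> (d s + d t) / 2"
    and "t \<in> {0..1}"
  shows "d t \<le> 0"
proof -
  obtain t\<^sub>0 where t\<^sub>0: "t\<^sub>0 \<in> {0..1}" and max: "\<And>t. t \<in> {0..1} \<Longrightarrow> d t \<le> d t\<^sub>0"
    using continuous_attains_sup[OF _ _ cont] by auto
  have "d t\<^sub>0 \<le> 0"
  proof (cases "t\<^sub>0 \<le> 1 / 2")
    case True
    then show ?thesis
      using mid[of 0 "2 * t\<^sub>0"] max[of "2 * t\<^sub>0"] t\<^sub>0 ends by simp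
  next
    case False
    then show ?thesis
      using mid[of 1 "2 * t\<^sub>0 - 1"] max[of "2 * t\<^sub>0 - 1"] t\<^sub>0 ends by simp
  qed
  then show ?thesis using max[OF assms(5)] by simp
qed

text \<open>On a line with direction \<open>v\<close>, the second difference bound says that \<open>C * (p v)\<^sup>2 * t\<^sup>2 - (p (y + t v))\<^sup>2\<close> is
  midpoint convex; by continuity it is convex.\<close>

lemma square_semiconcave:
  fixes p :: "'a::real_vector \<Rightarrow> real"
  assumes p: "is_norm p"
    and diff: "\<And>x h. (p (x + h))\<^sup>2 + (p (x - h))\<^sup>2 \<le> 2 * (p x)\<^sup>2 + 2 * C * (p h)\<^sup>2"
  shows "semiconvex (\<lambda>v. C * (p v)\<^sup>2) (\<lambda>x. - (p x)\<^sup>2)"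
proof (rule semiconvexI)
  fix x y :: 'a and l :: real assume l: "0 \<le> l" "l \<le> 1"
  define v where "v = x - y"
  define d where "d t = t * (p x)\<^sup>2 + (1 - t) * (p y)\<^sup>2 - t * (1 - t) * (C * (p v)\<^sup>2)
    - (p (y + t *\<^sub>R v))\<^sup>2" for t
  have increment: "p (y + s *\<^sub>R v) \<le> p (y + t *\<^sub>R v) + p v * \<bar>s - t\<bar>" for s t
  proof -
    have "y + s *\<^sub>R v = (y + t *\<^sub>R v) + (s - t) *\<^sub>R v"
      by (simp add: algebra_simps)
    then have "p (y + s *\<^sub>R v) = p ((y + t *\<^sub>R v) + (s - t) *\<^sub>R v)"
      by (rule arg_cong)
    then show ?thesis
      using is_normD(4)[OF p, of "y + t *\<^sub>R v" "(s - t) *\<^sub>R v"] is_normD(3)[OF p, of "s - t" v]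
      by (simp add: mult.commute)
  qed
  have "\<bar>p (y + s *\<^sub>R v) - p (y + t *\<^sub>R v)\<bar> \<le> p v * \<bar>s - t\<bar>" for s t
    using increment[of s t] increment[of t s] by (simp add: abs_le_iff abs_minus_commute)
  then have "(p v)-lipschitz_on UNIV (\<lambda>t. p (y + t *\<^sub>R v))"
    using is_normD(1)[OF p] by (intro lipschitz_onI) (auto simp: dist_real_def)
  then have "continuous_on {0..1} (\<lambda>t. p (y + t *\<^sub>R v))"
    by (meson lipschitz_on_continuous_on continuous_on_subset subset_UNIV)
  then have "continuous_on {0..1} d"
    unfolding d_def by (intro continuous_intros)
  moreover have "d ((s + t) / 2) \<le> (d s + d t) / 2" for s t
  proof -
    define m k where "m = y + ((s + t) / 2) *\<^sub>R v" and "k = ((s - t) / 2) *\<^sub>R v"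
    have "m + k = y + s *\<^sub>R v" "m - k = y + t *\<^sub>R v"
      by (simp_all add: m_def k_def algebra_simps add_divide_distrib diff_divide_distrib
          flip: scaleR_add_left)
    moreover have "(p k)\<^sup>2 = ((s - t) / 2)\<^sup>2 * (p v)\<^sup>2"
      by (simp add: k_def is_normD(3)[OF p] power_mult_distrib power_divide)
    ultimately have "(p (y + s *\<^sub>R v))\<^sup>2 + (p (y + t *\<^sub>R v))\<^sup>2
        \<le> 2 * (p m)\<^sup>2 + 2 * C * (((s - t) / 2)\<^sup>2 * (p v)\<^sup>2)"
      using diff[of m k] by simp
    then show ?thesis
      by (simp add: d_def m_def[symmetric] field_simps power2_eq_square)
  qed
  ultimately have "d l \<le> 0"
    using l by (intro midpoint_convex_nonpos[of d]) (auto simp: d_def v_def)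
  moreover have "y + l *\<^sub>R v = l *\<^sub>R x + (1 - l) *\<^sub>R y"
    by (simp add: v_def algebra_simps)
  ultimately show "- (p (l *\<^sub>R x + (1 - l) *\<^sub>R y))\<^sup>2
      \<le> l * - (p x)\<^sup>2 + (1 - l) * - (p y)\<^sup>2 + l * (1 - l) * (C * (p (x - y))\<^sup>2)"
    by (simp add: d_def v_def)
qed

context concave_modulus
begin

text \<open>Let \<open>z\<close> be the convex combination of \<open>x\<close> and \<open>y\<close>, and \<open>r = p (x - y)\<close>. If \<open>p z \<ge> r\<close>, the quadratic majorant
  at \<open>p z\<close> reduces the claim to \<open>square_semiconcave\<close>; its slope is at most
  \<open>\<omega> (p z) / p z \<le> \<omega> r / r\<close>. For small \<open>p z\<close> this slope is too large, but there a direct estimate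
  suffices: by symmetry let \<open>l \<le> 1 / 2\<close>, so that \<open>x\<close> has weight \<open>l\<close> and \<open>y\<close> has distance \<open>l * r\<close> from \<open>z\<close>,
  and both contributions are of the order of \<open>l * (r * \<omega> r)\<close>.\<close>

lemma gauge_of_norm_semiconcave:
  fixes p :: "'a::real_vector \<Rightarrow> real"
  assumes p: "is_norm p" and C: "0 \<le> C"
    and square: "semiconvex (\<lambda>v. C * (p v)\<^sup>2) (\<lambda>x. - (p x)\<^sup>2)"
  shows "semiconvex (\<lambda>v. (C + 16) * (p v * \<omega> (p v))) (\<lambda>x. - (p x * \<omega> (p x)))"
proof -
  define \<psi> where "\<psi> x = p x * \<omega> (p x)" for x
  have p_nonneg: "0 \<le> p x" for x by (rule is_normD(1)[OF p])
  have \<psi>_nonneg: "0 \<le> \<psi> x" for x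
    by (simp add: \<psi>_def p_nonneg nonneg)
  have half: "l * \<psi> x + (1 - l) * \<psi> y
      \<le> \<psi> (l *\<^sub>R x + (1 - l) *\<^sub>R y) + l * (1 - l) * ((C + 16) * \<psi> (x - y))"
    if l: "0 \<le> l" "l \<le> 1 / 2" for l x y
  proof -
    define z where "z = l *\<^sub>R x + (1 - l) *\<^sub>R y"
    define r where "r = p (x - y)"
    have l1: "l \<le> 1" using l by simp
    have r0: "0 \<le> r" by (simp add: r_def p_nonneg)
    have coeff: "0 \<le> l * (1 - l)" using l by simp
    have gr: "0 \<le> r * \<omega> r" using r0 nonneg by simp
    have "l * \<psi> x + (1 - l) * \<psi> y - \<psi> z \<le> l * (1 - l) * ((C + 16) * (r * \<omega> r))"
    proof (cases "0 < r \<and> r \<le> p z")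
      case True
      then have z0: "0 < p z" by simp
      obtain m where m: "0 \<le> m" "m * p z \<le> \<omega> (p z)"
        "\<And>t. 0 \<le> t \<Longrightarrow> t * \<omega> t \<le> p z * \<omega> (p z) + m * (t\<^sup>2 - (p z)\<^sup>2)"
        using gauge_quadratic_majorant[OF z0] by blast
      have maj: "\<psi> w \<le> \<psi> z + m * ((p w)\<^sup>2 - (p z)\<^sup>2)" for w
        using m(3)[of "p w"] p_nonneg by (simp add: \<psi>_def)
      have "l * \<psi> x + (1 - l) * \<psi> y
          \<le> l * (\<psi> z + m * ((p x)\<^sup>2 - (p z)\<^sup>2)) + (1 - l) * (\<psi> z + m * ((p y)\<^sup>2 - (p z)\<^sup>2))"
        using l by (intro add_mono mult_left_mono maj) auto
      also have "\<dots> = \<psi> z + m * (l * (p x)\<^sup>2 + (1 - l) * (p y)\<^sup>2 - (p z)\<^sup>2)"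
        by (simp add: algebra_simps)
      also have "\<dots> \<le> \<psi> z + m * (l * (1 - l) * (C * r\<^sup>2))"
        using semiconvexD[OF square l(1) l1, of x y] m(1)
        by (intro add_left_mono mult_left_mono) (simp_all add: z_def r_def)
      also have "m * (l * (1 - l) * (C * r\<^sup>2)) = (l * (1 - l) * C * r) * (m * r)"
        by (simp add: power2_eq_square)
      also have "\<dots> \<le> (l * (1 - l) * C * r) * \<omega> r"
      proof (intro mult_left_mono)
        have "m * r * p z \<le> \<omega> (p z) * r"
          using mult_right_mono[OF m(2) r0] by (simp add: mult_ac)
        also have "\<dots> \<le> \<omega> r * p z"
          using True by (intro quotient_antimono) auto
        finally show "m * r \<le> \<omega> r" using z0 by simp
      qed (use coeff C r0 in simp)
      also have "\<dots> \<le> l * (1 - l) * ((C + 16) * (r * \<omega> r))"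
        using mult_nonneg_nonneg[OF coeff gr] by (simp add: algebra_simps)
      finally show ?thesis by simp
    next
      case near: False
      show ?thesis
      proof (cases "r = 0")
        case True
        then have "x = y" using is_normD(2)[OF p, of "x - y"] by (simp add: r_def)
        then show ?thesis using True by (simp add: z_def algebra_simps flip: scaleR_add_left)
      next
        case False
        then have zr: "p z \<le> r" using near r0 by auto
        have "x = z + (1 - l) *\<^sub>R (x - y)" "y = z - l *\<^sub>R (x - y)"
          by (simp_all add: z_def algebra_simps)
        then have px: "p x \<le> p z + (1 - l) * r" and py: "p y \<le> p z + l * r"
          using is_normD(4)[OF p, of z "(1 - l) *\<^sub>R (x - y)"]
            is_normD(5)[OF p, of z "l *\<^sub>R (x - y)"] l
          by (auto simp: is_normD(3)[OF p] r_def)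
        have lr: "0 \<le> l * r" "l * r \<le> r" using l r0 by (auto intro: mult_left_le_one_le)
        have double: "(2 * r) * \<omega> (2 * r) \<le> 4 * (r * \<omega> r)"
          using gauge_scale[of 2 r] r0 by simp
        have "\<psi> x \<le> (2 * r) * \<omega> (2 * r)"
          unfolding \<psi>_def using px zr lr p_nonneg by (intro gauge_mono) (auto simp: algebra_simps)
        then have x: "l * \<psi> x \<le> l * (4 * (r * \<omega> r))"
          using double l by (intro mult_left_mono) auto
        have "\<psi> y \<le> (p z + l * r) * \<omega> (p z + l * r)"
          unfolding \<psi>_def using py p_nonneg by (intro gauge_mono) auto
        then have "\<psi> y - \<psi> z \<le> 2 * (l * r) * \<omega> (p z + l * r)"
          using gauge_increment[of "p z" "p z + l * r"] lr p_nonneg by (simp add: \<psi>_def)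
        also have "\<dots> \<le> 2 * (l * r) * (2 * \<omega> r)"
          using lr zr p_nonneg[of z] mono[of "p z + l * r" "2 * r"] scale[of 2 r] r0
          by (intro mult_left_mono) auto
        finally have "\<psi> y - \<psi> z \<le> l * (4 * (r * \<omega> r))" by simp
        moreover have "(1 - l) * \<psi> y \<le> \<psi> y"
          using l \<psi>_nonneg by (intro mult_left_le_one_le) auto
        ultimately have "l * \<psi> x + (1 - l) * \<psi> y - \<psi> z \<le> l * (8 * (r * \<omega> r))"
          using x by simp
        also have "\<dots> \<le> l * ((1 - l) * (16 * (r * \<omega> r)))"
          using l gr mult_right_mono[of "1/2" "1 - l" "16 * (r * \<omega> r)"]
          by (intro mult_left_mono) auto
        also have "\<dots> \<le> l * ((1 - l) * ((C + 16) * (r * \<omega> r)))"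
          using l gr C by (intro mult_left_mono mult_right_mono) auto
        finally show ?thesis by (simp add: mult.assoc)
      qed
    qed
    then show ?thesis by (simp add: z_def r_def \<psi>_def)
  qed
  have "- \<psi> (l *\<^sub>R x + (1 - l) *\<^sub>R y)
      \<le> l * - \<psi> x + (1 - l) * - \<psi> y + l * (1 - l) * ((C + 16) * \<psi> (x - y))"
    if l: "0 \<le> l" "l \<le> 1" for l x y
  proof (cases "l \<le> 1 / 2")
    case True
    then show ?thesis using half[OF l(1), of x y] by simp
  next
    case False
    moreover have "\<psi> (y - x) = \<psi> (x - y)"
      using is_normD(6)[OF p, of "x - y"] by (simp add: \<psi>_def)
    ultimately show ?thesis
      using half[of "1 - l" y x] l by (simp add: add.commute mult.commute)
  qed
  then show ?thesis
    unfolding \<psi>_def by (rule semiconvexI)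
qed

end

section \<open>The extension theorem\<close>

lemma semiconvex_affine_plus:
  fixes T :: "'a::real_normed_vector \<Rightarrow>\<^sub>L real"
  assumes "semiconvex \<sigma> u" "0 \<le> A"
    and le: "\<And>v. A * \<sigma> v \<le> \<sigma>' v"
  shows "semiconvex \<sigma>' (\<lambda>x. c + T (x - y) + A * u (x - y))"
proof (rule semiconvexI)
  fix x z :: 'a and l :: real assume l: "0 \<le> l" "l \<le> 1"
  have split: "l *\<^sub>R x + (1 - l) *\<^sub>R z - y = l *\<^sub>R (x - y) + (1 - l) *\<^sub>R (z - y)"
    by (simp add: algebra_simps)
  have "A * u (l *\<^sub>R x + (1 - l) *\<^sub>R z - y)
      \<le> A * (l * u (x - y) + (1 - l) * u (z - y) + l * (1 - l) * \<sigma> (x - z))"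
    using semiconvexD[OF assms(1) l, of "x - y" "z - y"] assms(2)
    unfolding split by (intro mult_left_mono) simp_all
  moreover have "l * (1 - l) * (A * \<sigma> (x - z)) \<le> l * (1 - l) * \<sigma>' (x - z)"
    using l le by (intro mult_left_mono) auto
  moreover have "T (l *\<^sub>R x + (1 - l) *\<^sub>R z - y) = l * T (x - y) + (1 - l) * T (z - y)"
    unfolding split by (simp add: blinfun.add_right blinfun.scaleR_right)
  ultimately show "c + T (l *\<^sub>R x + (1 - l) *\<^sub>R z - y) + A * u (l *\<^sub>R x + (1 - l) *\<^sub>R z - y)
      \<le> l * (c + T (x - y) + A * u (x - y)) + (1 - l) * (c + T (z - y) + A * u (z - y))
        + l * (1 - l) * \<sigma>' (x - z)"
    by (simp add: algebra_simps)
qed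

context concave_modulus
begin

lemma WG_if_C1_mod:
  fixes E :: "'a::real_normed_vector set"
  assumes "F \<in> C1_mod UNIV \<omega>" and eq: "\<And>x. x \<in> E \<Longrightarrow> F x = f x"
  shows "\<exists>G. WG \<omega> E f G"
proof -
  obtain D :: "'a \<Rightarrow> 'a \<Rightarrow>\<^sub>L real" and C where
    D: "\<And>x. (F has_derivative blinfun_apply (D x)) (at x)" and C: "0 \<le> C"
    and lip: "\<And>x y. norm (D x - D y) \<le> C * \<omega> (norm (x - y))"
    using assms(1) by (auto simp: C1_mod_def)
  have le: "C * w \<le> (C + 1) * w" if "0 \<le> w" for w :: real
    using that by (simp add: algebra_simps)
  have "WG \<omega> E f D"
    unfolding WG_def
  proof (intro exI[of _ "C + 1"] conjI ballI)
    fix x y assume E: "x \<in> E" "y \<in> E"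
    show "norm (D y - D x) \<le> (C + 1) * \<omega> (norm (y - x))"
      using lip[of y x] le[OF nonneg[of "norm (y - x)"]] by simp
    have "norm ((F y - D x y) - (F x - D x x)) \<le> (C * \<omega> (norm (y - x))) * norm (y - x)"
    proof (rule differentiable_bound[where S = "closed_segment x y" and f = "\<lambda>z. F z - D x z"
          and f' = "\<lambda>z. blinfun_apply (D z - D x)"])
      fix z assume z: "z \<in> closed_segment x y"
      have "((\<lambda>z. F z - D x z) has_derivative (\<lambda>v. D z v - D x v)) (at z)"
        by (intro has_derivative_diff D bounded_linear_imp_has_derivative
            blinfun.bounded_linear_right)
      then show "((\<lambda>z. F z - D x z) has_derivative blinfun_apply (D z - D x))
          (at z within closed_segment x y)"
        by (simp add: blinfun.diff_left[abs_def] minus_blinfun.rep_eq has_derivative_at_withinI)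
      have "norm (z - x) \<le> norm (y - x)"
        using z segment_bound1[of z x y] by (simp add: norm_minus_commute)
      then have "C * \<omega> (norm (z - x)) \<le> C * \<omega> (norm (y - x))"
        using C mono by (intro mult_left_mono) auto
      then show "onorm (blinfun_apply (D z - D x)) \<le> C * \<omega> (norm (y - x))"
        using lip[of z x] by (simp add: norm_blinfun.rep_eq)
    qed auto
    moreover have "C * \<omega> (norm (y - x)) * norm (y - x)
        \<le> (C + 1) * \<omega> (norm (y - x)) * norm (y - x)"
      using le[OF nonneg[of "norm (y - x)"]] by (intro mult_right_mono[OF _ norm_ge_zero]) simp
    ultimately show "\<bar>f y - f x - D x (y - x)\<bar> \<le> (C + 1) * \<omega> (norm (y - x)) * norm (y - x)"
      using eq[OF E(1)] eq[OF E(2)] by (simp add: blinfun.diff_right algebra_simps)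
  qed (use C in simp)
  then show ?thesis by blast
qed

text \<open>The two first-order Taylor polynomials are compared first at the one of \<open>y\<close> and \<open>z\<close> that is nearer to
  \<open>x\<close>, and then at \<open>x\<close>, which costs \<open>M * \<omega> (\<parallel>y - z\<parallel>) * (\<parallel>y - z\<parallel> + s)\<close> with \<open>s\<close> the smaller of the distances
  to \<open>x\<close>. If \<open>r\<close> is the larger one, then \<open>\<parallel>y - z\<parallel> \<le> 2 * r\<close>, and the constant is \<open>6 = 2 * 3\<close>.\<close>

lemma jet_compatibility:
  fixes f :: "'a::real_normed_vector \<Rightarrow> real" and G :: "'a \<Rightarrow> 'a \<Rightarrow>\<^sub>L real"
  assumes M: "0 < M"
    and G: "norm (G y - G z) \<le> M * \<omega> (norm (y - z))"
    and fy: "\<bar>f y - f z - G z (y - z)\<bar> \<le> M * \<omega> (norm (y - z)) * norm (y - z)"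
    and fz: "\<bar>f z - f y - G y (z - y)\<bar> \<le> M * \<omega> (norm (y - z)) * norm (y - z)"
  shows "(f y + G y (x - y)) - (f z + G z (x - z))
    \<le> 6 * M * (norm (x - y) * \<omega> (norm (x - y))) + 6 * M * (norm (x - z) * \<omega> (norm (x - z)))"
proof -
  define r where "r = max (norm (x - y)) (norm (x - z))"
  define s where "s = min (norm (x - y)) (norm (x - z))"
  have r0: "0 \<le> r" by (simp add: r_def le_max_iff_disj)
  have s: "0 \<le> s" "s \<le> r" by (auto simp: r_def s_def)
  have yz: "norm (y - z) \<le> 2 * r"
    using norm_triangle_ineq4[of "x - z" "x - y"] by (simp add: r_def)
  have jet: "(f y + G y (x - y)) - (f z + G z (x - z))
      \<le> M * \<omega> (norm (y - z)) * norm (y - z) + M * \<omega> (norm (y - z)) * s"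
  proof (cases "norm (x - y) \<le> norm (x - z)")
    case True
    have "(f y + G y (x - y)) - (f z + G z (x - z))
        = (f y - f z - G z (y - z)) + (G y - G z) (x - y)"
      by (simp add: blinfun.diff_left blinfun.diff_right)
    also have "(G y - G z) (x - y) \<le> M * \<omega> (norm (y - z)) * s"
      using norm_blinfun[of "G y - G z" "x - y"] mult_right_mono[OF G, of "norm (x - y)"] True
      by (simp add: s_def)
    finally show ?thesis using fy by simp
  next
    case False
    have "(f y + G y (x - y)) - (f z + G z (x - z))
        = - (f z - f y - G y (z - y)) + (G y - G z) (x - z)"
      by (simp add: blinfun.diff_left blinfun.diff_right)
    also have "(G y - G z) (x - z) \<le> M * \<omega> (norm (y - z)) * s"
      using norm_blinfun[of "G y - G z" "x - z"] mult_right_mono[OF G, of "norm (x - z)"] False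
      by (simp add: s_def)
    finally show ?thesis using fz by simp
  qed
  also have "\<dots> = M * \<omega> (norm (y - z)) * (norm (y - z) + s)"
    by (simp add: algebra_simps)
  also have "\<dots> \<le> M * (2 * \<omega> r) * (3 * r)"
  proof (intro mult_mono)
    show "\<omega> (norm (y - z)) \<le> 2 * \<omega> r"
      using mono[OF _ yz] scale[of 2 r] r0 by simp
  qed (use M yz s r0 nonneg in auto)
  also have "\<dots> = 6 * M * (r * \<omega> r)" by simp
  also have "\<dots> \<le> 6 * M * (norm (x - y) * \<omega> (norm (x - y)))
      + 6 * M * (norm (x - z) * \<omega> (norm (x - z)))"
    using M nonneg by (auto simp: r_def max_def)
  finally show ?thesis .
qed

lemma C1_mod_extension:
  fixes f :: "'a::real_normed_vector \<Rightarrow> real"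
  assumes "\<exists>\<nu> :: 'a \<Rightarrow> real. equivalent_norm \<nu> \<and> smoothness_power_type \<nu> 2" and WG: "WG \<omega> E f G"
  shows "\<exists>F \<in> C1_mod UNIV \<omega>. (\<forall>x\<in>E. F x = f x) \<and>
    (\<forall>x\<in>E. (F has_derivative blinfun_apply (G x)) (at x))"
proof (cases "E = {}")
  case True
  have "(\<lambda>x. 0) \<in> C1_mod UNIV \<omega>"
    by (auto simp: C1_mod_def zero_blinfun.rep_eq intro!: exI[of _ "\<lambda>x. 0"] exI[of _ 0])
  with True show ?thesis by auto
next
  case False
  then obtain y\<^sub>0 where y\<^sub>0: "y\<^sub>0 \<in> E" by auto
  obtain M where M: "0 < M" and
    G: "\<And>x y. x \<in> E \<Longrightarrow> y \<in> E \<Longrightarrow> norm (G y - G x) \<le> M * \<omega> (norm (y - x))" and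
    f: "\<And>x y. x \<in> E \<Longrightarrow> y \<in> E \<Longrightarrow>
      \<bar>f y - f x - G x (y - x)\<bar> \<le> M * \<omega> (norm (y - x)) * norm (y - x)"
    using WG by (auto simp: WG_def)
  obtain p :: "'a \<Rightarrow> real" and B C where p: "is_norm p" and B: "1 \<le> B" and p_lower: "\<And>x. norm x \<le> p x"
    and p_upper: "\<And>x. p x \<le> B * norm x" and C: "0 \<le> C"
    and diff: "\<And>x h. (p (x + h))\<^sup>2 + (p (x - h))\<^sup>2 \<le> 2 * (p x)\<^sup>2 + 2 * C * (p h)\<^sup>2"
    using normalized_smooth_norm[OF assms(1)] by metis
  define \<psi> where "\<psi> x = p x * \<omega> (p x)" for x
  define A where "A = 6 * M"
  define N where "N = A * ((C + 16) * B\<^sup>2)"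
  define \<sigma> where "\<sigma> v = N * (norm v * \<omega> (norm v))" for v :: 'a
  define lo where "lo y x = f y + G y (x - y) + A * - \<psi> (x - y)" for x y
  define up where "up y x = f y + G y (x - y) + A * \<psi> (x - y)" for x y
  have A: "0 < A" using M by (simp add: A_def)
  have N: "0 \<le> N" using A C by (simp add: N_def)
  have p0: "p 0 = 0" by (rule is_normD(7)[OF p])
  have \<psi>_lower: "norm v * \<omega> (norm v) \<le> \<psi> v" for v
    unfolding \<psi>_def using p_lower by (intro gauge_mono) auto
  have \<psi>_upper: "\<psi> v \<le> B\<^sup>2 * (norm v * \<omega> (norm v))" for v
  proof -
    have "\<psi> v \<le> (B * norm v) * \<omega> (B * norm v)"
      unfolding \<psi>_def using p_upper is_normD(1)[OF p] by (intro gauge_mono) auto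
    also have "\<dots> \<le> B\<^sup>2 * (norm v * \<omega> (norm v))"
      using B by (intro gauge_scale) auto
    finally show ?thesis .
  qed
  have \<psi>_semi: "semiconvex (\<lambda>v. (C + 16) * \<psi> v) (\<lambda>x. - \<psi> x)"
    unfolding \<psi>_def using p C square_semiconcave[OF p diff] by (rule gauge_of_norm_semiconcave)
  have \<sigma>: "A * ((C + 16) * \<psi> v) \<le> \<sigma> v" for v
  proof -
    have "A * ((C + 16) * \<psi> v) \<le> A * ((C + 16) * (B\<^sup>2 * (norm v * \<omega> (norm v))))"
      using A C \<psi>_upper by (intro mult_left_mono) auto
    then show ?thesis by (simp add: \<sigma>_def N_def)
  qed
  have lo_semi: "semiconvex \<sigma> (lo y)" for y
    unfolding lo_def using \<psi>_semi less_imp_le[OF A] \<sigma> by (rule semiconvex_affine_plus)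
  have up_semi: "semiconvex \<sigma> (\<lambda>x. - up y x)" for y
  proof -
    have "semiconvex \<sigma> (\<lambda>x. - f y + (- G y) (x - y) + A * - \<psi> (x - y))"
      using \<psi>_semi less_imp_le[OF A] \<sigma> by (rule semiconvex_affine_plus)
    moreover have "(\<lambda>x. - f y + (- G y) (x - y) + A * - \<psi> (x - y)) = (\<lambda>x. - up y x)"
      by (auto simp: up_def blinfun.minus_left)
    ultimately show ?thesis by simp
  qed
  have lo_up: "lo y x \<le> up z x" if "y \<in> E" "z \<in> E" for x y z
  proof -
    have "(f y + G y (x - y)) - (f z + G z (x - z))
        \<le> A * (norm (x - y) * \<omega> (norm (x - y))) + A * (norm (x - z) * \<omega> (norm (x - z)))"
      unfolding A_def
      using M G[OF that(2,1)] f[OF that(2,1)] f[OF that(1,2)]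
      by (intro jet_compatibility) (auto simp: norm_minus_commute)
    also have "\<dots> \<le> A * \<psi> (x - y) + A * \<psi> (x - z)"
      using A \<psi>_lower by (intro add_mono mult_left_mono) auto
    finally show ?thesis by (simp add: lo_def up_def)
  qed
  obtain F where F: "semiconvex \<sigma> F" "semiconvex \<sigma> (\<lambda>x. - F x)"
    and lo: "\<And>u x. u \<in> lo ` E \<Longrightarrow> u x \<le> F x" and up: "\<And>w x. w \<in> up ` E \<Longrightarrow> F x \<le> w x"
    using semiconvex_semiconcave_insertion[of "lo ` E" "up ` E" \<sigma>] y\<^sub>0 lo_semi up_semi lo_up
    by blast
  have jet: "\<bar>F (y + v) - f y - G y v\<bar> \<le> A * \<psi> v" if "y \<in> E" for y v
    using lo[of "lo y" "y + v"] up[of "up y" "y + v"] that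
    by (auto simp: lo_def up_def abs_le_iff)
  have eq: "F y = f y" if "y \<in> E" for y
    using jet[OF that, of 0] by (simp add: \<psi>_def p0)
  have jet_norm: "\<bar>F (y + v) - F y - G y v\<bar> \<le> (A * B\<^sup>2) * (norm v * \<omega> (norm v))"
    if "y \<in> E" for y v
    using order_trans[OF jet[OF that] mult_left_mono[OF \<psi>_upper]] A eq[OF that]
    by (simp add: mult.assoc)
  have "\<exists>c. \<forall>v. norm v = 1 \<longrightarrow> \<bar>F (x + v)\<bar> \<le> c" for x
  proof (intro exI allI impI)
    fix v :: 'a assume "norm v = 1"
    define R where "R = norm (x - y\<^sub>0) + 1"
    have R: "norm (x - y\<^sub>0 + v) \<le> R"
      using norm_triangle_ineq[of "x - y\<^sub>0" v] \<open>norm v = 1\<close> by (simp add: R_def)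
    have "\<bar>F (x + v) - F y\<^sub>0 - G y\<^sub>0 (x - y\<^sub>0 + v)\<bar>
        \<le> (A * B\<^sup>2) * (norm (x - y\<^sub>0 + v) * \<omega> (norm (x - y\<^sub>0 + v)))"
      using jet_norm[OF y\<^sub>0, of "x - y\<^sub>0 + v"] by (simp add: algebra_simps)
    also have "\<dots> \<le> (A * B\<^sup>2) * (R * \<omega> R)"
      using A R by (intro mult_left_mono gauge_mono) auto
    finally have "\<bar>F (x + v) - F y\<^sub>0 - G y\<^sub>0 (x - y\<^sub>0 + v)\<bar> \<le> (A * B\<^sup>2) * (R * \<omega> R)" .
    moreover have "\<bar>G y\<^sub>0 (x - y\<^sub>0 + v)\<bar> \<le> norm (G y\<^sub>0) * R"
      using norm_blinfun[of "G y\<^sub>0" "x - y\<^sub>0 + v"] mult_left_mono[OF R, of "norm (G y\<^sub>0)"] by simp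
    ultimately show "\<bar>F (x + v)\<bar> \<le> \<bar>F y\<^sub>0\<bar> + norm (G y\<^sub>0) * (norm (x - y\<^sub>0) + 1)
        + (A * B\<^sup>2) * ((norm (x - y\<^sub>0) + 1) * \<omega> (norm (x - y\<^sub>0) + 1))"
      unfolding R_def by linarith
  qed
  with N F have "F \<in> C1_mod UNIV \<omega>"
    unfolding \<sigma>_def by (intro C1_mod_if_semiconvex_semiconcave)
  moreover have "(F has_derivative blinfun_apply (G y)) (at y)" if "y \<in> E" for y
    using blinfun.bounded_linear_right jet_norm[OF that] by (rule has_derivative_if_gauge_bound)
  ultimately show ?thesis using eq by blast
qed

end

theorem theorem2:
  fixes \<omega> :: "real \<Rightarrow> real" and E :: "'a::banach set" and f :: "'a \<Rightarrow> real"
  assumes "\<omega> \<in> moduli" and "concave_on {0..} \<omega>"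
    and "super_reflexive TYPE('a)"
    and "\<exists>\<nu> :: 'a \<Rightarrow> real. equivalent_norm \<nu> \<and> smoothness_power_type \<nu> 2"
  shows "((\<exists>F \<in> C1_mod UNIV \<omega>. \<forall>x\<in>E. F x = f x) \<longleftrightarrow> (\<exists>G. WG \<omega> E f G)) \<and>
    (\<forall>G. WG \<omega> E f G \<longrightarrow>
      (\<exists>F \<in> C1_mod UNIV \<omega>. (\<forall>x\<in>E. F x = f x) \<and>
        (\<forall>x\<in>E. (F has_derivative blinfun_apply (G x)) (at x))))"
proof -
  interpret concave_modulus \<omega>
    using assms(1,2) by unfold_locales
  show ?thesis
    using C1_mod_extension[OF assms(4)] WG_if_C1_mod by blast
qed

end
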